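(* Let $n\ge1$ and let $T$ be the $2n\times 2$ matrix with rows $[x_i,y_i]$, $i=1,\dots,2n$. Let $\Delta_i=x_{2i-1}y_{2i}+x_{2i}y_{2i-1}$ and $S_i=(x_{2i-1}y_{2i-1}x_{2i}y_{2i})^{1/2}$ for $i=1,\dots,n$. Then $$ M(AD_{n};\mathrm{y}_T)=M(AD_{n-1};\mathrm{y}_{\mathrm{r}(T)})\prod_{i=1}^n\frac{\Delta_i}{S_i} $$ for $n$ even, and $$ M(AD_{n};\mathrm{y}_T)=M(AD_{n-1};\mathrm{y}_{\mathrm{r}(T)})\prod_{i=1}^n\Delta_i $$ for $n$ odd.
   Context: For $n\ge0$, the Aztec diamond graph $AD_n$ has vertices $u_{i,j}$ ($0\le i\le n$, $1\le j\le n$) and $v_{i,j}$ ($1\le i\le n$, $0\le j\le n$), and $4n^2$ edges $\epsilon_{r,s}$, $1\le r,s\le 2n$ (the edge centers form a $2n\times2n$ array), where for $1\le i,j\le n$: $\epsilon_{2i-1,2j-1}=u_{i-1,j}v_{i,j-1}$, $\epsilon_{2i-1,2j}=u_{i-1,j}v_{i,j}$, $\epsilon_{2i,2j-1}=u_{i,j}v_{i,j-1}$, $\epsilon_{2i,2j}=u_{i,j}v_{i,j}$. $AD_0$ is the empty graph. The weight of a perfect matching is the product of the weights of its edges, and $M(G;\mathrm{wt})$ is the sum of the weights of all perfect matchings of $G$ (equal to $1$ for the empty graph). For a $2n\times2$ matrix $T$ with rows $[x_i,y_i]$ (with invertible entries), $\mathrm{y}_T$ is the weight on $AD_n$ assigning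 to $\epsilon_{r,s}$ the value $x_r$, $y_r$, $1/x_r$, $1/y_r$ according as $s\equiv 1,2,3,0 \pmod 4$. The operator $\mathrm{r}$ sends $T$ to the $(2n-2)\times 2$ matrix $\mathrm{r}(T)$ whose row $2k-1$ is $[\,x_{2k-1}/S_k,\ S_k/y_{2k-1}\,]$ and whose row $2k$ is $[\,x_{2k+2}/S_{k+1},\ S_{k+1}/y_{2k+2}\,]$, for $k=1,\dots,n-1$, with $S_i=(x_{2i-1}y_{2i-1}x_{2i}y_{2i})^{1/2}$. The $x_i,y_i$ are independent indeterminates; square roots are taken in the field $\mathbb Q(\xi_1,\eta_1,\dots,\xi_{2n},\eta_{2n})$ with $x_i=\xi_i^2$, $y_i=\eta_i^2$, so that $S_i=\xi_{2i-1}\eta_{2i-1}\xi_{2i}\eta_{2i}$. *)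

theory Defs
  imports
    Complex_Main
    "HOL-Library.Poly_Mapping"
    "HOL-Computational_Algebra.Fraction_Field"
begin

section \<open>Weighted matching sums\<close>

text \<open>A finite simple graph is a pair of a vertex set and a set of edges, each edge being the
  set of its two endpoints.\<close>

type_synonym 'v graph = "'v set \<times> 'v set set"

definition perfect_matchings :: "'v graph \<Rightarrow> 'v set set set" where
  "perfect_matchings G = {P. P \<subseteq> snd G \<and> (\<forall>v \<in> fst G. \<exists>!e. e \<in> P \<and> v \<in> e)}"

definition matching_sum :: "'v graph \<Rightarrow> ('v set \<Rightarrow> 'a :: comm_semiring_1) \<Rightarrow> 'a" where
  "matching_sum G wt = (\<Sum>P \<in> perfect_matchings G. \<Prod>e \<in> P. wt e)"


section \<open>Aztec diamond graphs\<close>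

datatype vertex = U nat nat | V nat nat

definition eps :: "nat \<Rightarrow> nat \<Rightarrow> vertex set" where
  "eps r s = {U (r div 2) ((s + 1) div 2), V ((r + 1) div 2) (s div 2)}"

lemma eps_cases:
  assumes "1 \<le> i" and "1 \<le> j"
  shows "eps (2*i - 1) (2*j - 1) = {U (i - 1) j, V i (j - 1)}"
    and "eps (2*i - 1) (2*j) = {U (i - 1) j, V i j}"
    and "eps (2*i) (2*j - 1) = {U i j, V i (j - 1)}"
    and "eps (2*i) (2*j) = {U i j, V i j}"
proof -
  obtain a b where "i = Suc a" "j = Suc b"
    using assms by (metis One_nat_def Suc_le_D)
  then show "eps (2*i - 1) (2*j - 1) = {U (i - 1) j, V i (j - 1)}"
    and "eps (2*i - 1) (2*j) = {U (i - 1) j, V i j}"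
    and "eps (2*i) (2*j - 1) = {U i j, V i (j - 1)}"
    and "eps (2*i) (2*j) = {U i j, V i j}"
    by (simp_all add: eps_def)
qed

definition AD :: "nat \<Rightarrow> vertex graph" where
  "AD n =
    ({U i j | i j. i \<le> n \<and> 1 \<le> j \<and> j \<le> n} \<union> {V i j | i j. 1 \<le> i \<and> i \<le> n \<and> j \<le> n},
     {eps r s | r s. r \<in> {1..2*n} \<and> s \<in> {1..2*n}})"

lemma inj_eps: "inj (\<lambda>(r, s). eps r s)"
proof (rule injI, clarify)
  fix r s r' s' :: nat
  assume "eps r s = eps r' s'"
  then have "r div 2 = r' div 2" "(r + 1) div 2 = (r' + 1) div 2"
    and "s div 2 = s' div 2" "(s + 1) div 2 = (s' + 1) div 2"
    by (auto simp: eps_def doubleton_eq_iff)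
  moreover have "k = k div 2 + (k + 1) div 2" for k :: nat
    by linarith
  ultimately show "r = r' \<and> s = s'"
    by metis
qed

lemma AD_0: "AD 0 = ({}, {})"
  by (auto simp: AD_def)

lemma matching_sum_AD_0: "matching_sum (AD 0) wt = 1"
proof -
  have "perfect_matchings (AD 0) = {{}}"
    by (auto simp: perfect_matchings_def AD_0)
  then show ?thesis
    by (simp add: matching_sum_def)
qed


section \<open>The weights and the operator on two-column matrices\<close>

text \<open>A \<open>2n \<times> 2\<close> matrix is given by its rows \<open>T 1, \<dots>, T (2n)\<close>, counted from 1; the
  other values of \<open>T\<close> play no role.\<close>

type_synonym 'a rows = "nat \<Rightarrow> 'a \<times> 'a"

definition y_weight :: "'a :: field rows \<Rightarrow> vertex set \<Rightarrow> 'a" where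
  "y_weight T e =
    (case the_inv (\<lambda>(r, s). eps r s) e of (r, s) \<Rightarrow>
      if s mod 4 = 1 then fst (T r)
      else if s mod 4 = 2 then snd (T r)
      else if s mod 4 = 3 then 1 / fst (T r)
      else 1 / snd (T r))"

lemma y_weight_eps:
  "y_weight T (eps r s) =
    (if s mod 4 = 1 then fst (T r)
     else if s mod 4 = 2 then snd (T r)
     else if s mod 4 = 3 then 1 / fst (T r)
     else 1 / snd (T r))"
proof -
  have "the_inv (\<lambda>(r, s). eps r s) (eps r s) = (r, s)"
    using the_inv_f_f[OF inj_eps, of "(r, s)"] by simp
  then show ?thesis
    by (simp add: y_weight_def)
qed

text \<open>The chosen square roots \<open>S k\<close> of \<open>x\<^bsub>2k-1\<^esub> y\<^bsub>2k-1\<^esub> x\<^bsub>2k\<^esub> y\<^bsub>2k\<^esub>\<close>, where row \<open>i\<close> of \<open>T\<close>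
  is \<open>[x\<^sub>i, y\<^sub>i]\<close>, are passed as an argument.\<close>

definition r_op :: "(nat \<Rightarrow> 'a :: field) \<Rightarrow> 'a rows \<Rightarrow> 'a rows" where
  "r_op S T m =
    (if odd m then let k = (m + 1) div 2 in
       (fst (T (2*k - 1)) / S k, S k / snd (T (2*k - 1)))
     else let k = m div 2 in
       (fst (T (2*k + 2)) / S (k + 1), S (k + 1) / snd (T (2*k + 2))))"


section \<open>The field of rational functions\<close>

text \<open>\<open>nat \<Rightarrow>\<^sub>0 nat\<close> is the monoid of monomials in countably many indeterminates, so the
  following is the field \<open>\<rat>(z\<^sub>0, z\<^sub>1, z\<^sub>2, \<dots>)\<close>; the indeterminates of even and of odd index
  are used as the \<open>\<xi>\<close>'s and the \<open>\<eta>\<close>'s.\<close>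

type_synonym ratfun = "((nat \<Rightarrow>\<^sub>0 nat) \<Rightarrow>\<^sub>0 rat) fract"

definition indet :: "nat \<Rightarrow> ratfun" where
  "indet k = Fract (Poly_Mapping.single (Poly_Mapping.single k 1) 1) 1"

definition xi :: "nat \<Rightarrow> ratfun" where
  "xi i = indet (2*i)"

definition eta :: "nat \<Rightarrow> ratfun" where
  "eta i = indet (2*i + 1)"

end

theory Submission
  imports Defs "HOL-Library.FuncSet"
begin

text \<open>The edges of \<open>AD\<^bsub>m+1\<^esub>\<close> split into \<open>(m+1)\<^sup>2\<close> four-cycles, the cells. A matching assigns each
  vertex to the cell containing its edge, and the matching sum is the sum over these assignments of
  the products over all cells of the matching sums on the vertices assigned to the cell. An inner
  vertex lies in exactly two cells, a boundary vertex in one. Moving every inner vertex to its other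
  cell and dropping the boundary vertices replaces the vertex set assigned to each cell by its
  complement in the cell. In a four-cycle this multiplies the matching sum by \<open>1 / D\<close>, where \<open>D\<close> is
  the sum over its two perfect matchings, if the weight of each edge is replaced by that of the
  opposite edge over \<open>D\<close>. Without its boundary, \<open>AD\<^bsub>m+1\<^esub>\<close> is \<open>AD\<^bsub>m\<^esub>\<close>, so this reduces the order
  by one for arbitrary weights. For \<open>y\<^sub>T\<close> the new weights are those of \<open>y\<^bsub>r(T)\<^esub>\<close> times
  \<open>S\<^sub>i / \<Delta>\<^sub>i\<close> along the edges meeting a common row of vertices, a gauge factor.\<close>

section \<open>Matching sums and cell decompositions\<close>

text \<open>\<open>E\<close> and \<open>Q\<close> are separate arguments so that the edges of one
  cell can be combined with every set of its vertices; the value is 0 if \<open>Q\<close> has no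
  perfect matching by edges of \<open>E\<close>.\<close>

definition induced_sum :: "'v set set \<Rightarrow> 'v set \<Rightarrow> ('v set \<Rightarrow> 'a :: comm_semiring_1) \<Rightarrow> 'a" where
  "induced_sum E Q wt = matching_sum (Q, {e \<in> E. e \<subseteq> Q}) wt"

lemma perfect_matchings_induced_iff:
  "P \<in> perfect_matchings (Q, {e \<in> E. e \<subseteq> Q}) \<longleftrightarrow>
    P \<subseteq> E \<and> (\<forall>e\<in>P. e \<subseteq> Q) \<and> (\<forall>v\<in>Q. \<exists>!e. e \<in> P \<and> v \<in> e)"
  by (auto simp: perfect_matchings_def)

lemma finite_perfect_matchings: "finite (snd G) \<Longrightarrow> finite (perfect_matchings G)"
  by (rule finite_subset[of _ "Pow (snd G)"]) (auto simp: perfect_matchings_def)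

text \<open>A perfect matching of \<open>X\<close> assigns to each vertex the class of its edge, and
  its edges of class \<open>c\<close> match the fibre over \<open>c\<close> perfectly; conversely,
  perfect matchings of the fibres glue. \<open>K v\<close> may contain classes without an edge at
  \<open>v\<close>: assignments using them contribute 0.\<close>

lemma induced_sum_cells:
  fixes wt :: "'v set \<Rightarrow> 'a :: comm_semiring_1" and cl :: "'v set \<Rightarrow> 'c"
  assumes "finite E" "finite X" "finite C" and cl: "cl ` E \<subseteq> C"
    and K: "\<And>e v. e \<in> E \<Longrightarrow> v \<in> e \<Longrightarrow> cl e \<in> K v" and "\<And>v. v \<in> X \<Longrightarrow> finite (K v)"
    and KC: "\<And>v. v \<in> X \<Longrightarrow> K v \<subseteq> C"
  shows "induced_sum E X wt =
    (\<Sum>\<sigma> \<in> PiE X K. \<Prod>c\<in>C. induced_sum {e \<in> E. cl e = c} {v \<in> X. \<sigma> v = c} wt)"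
proof -
  define A where "A \<sigma> c = perfect_matchings ({v \<in> X. \<sigma> v = c},
    {e \<in> {e \<in> E. cl e = c}. e \<subseteq> {v \<in> X. \<sigma> v = c}})" for \<sigma> c
  have A_iff: "P \<in> A \<sigma> c \<longleftrightarrow> P \<subseteq> {e \<in> E. cl e = c} \<and> (\<forall>e\<in>P. e \<subseteq> {v \<in> X. \<sigma> v = c}) \<and>
    (\<forall>v\<in>{v \<in> X. \<sigma> v = c}. \<exists>!e. e \<in> P \<and> v \<in> e)" for P \<sigma> c
    unfolding A_def by (rule perfect_matchings_induced_iff)
  have finA: "finite (A \<sigma> c)" for \<sigma> c
    unfolding A_def using \<open>finite E\<close> by (intro finite_perfect_matchings) simp
  define B where "B = perfect_matchings (X, {e \<in> E. e \<subseteq> X})"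
  have B_iff: "P \<in> B \<longleftrightarrow> P \<subseteq> E \<and> (\<forall>e\<in>P. e \<subseteq> X) \<and> (\<forall>v\<in>X. \<exists>!e. e \<in> P \<and> v \<in> e)" for P
    unfolding B_def by (rule perfect_matchings_induced_iff)
  \<comment> \<open>The edge of \<open>P\<close> covering \<open>v\<close>, well defined for
    \<open>P\<close> in \<open>B\<close> and \<open>v\<close> in \<open>X\<close>.\<close>
  define ed where "ed P v = (THE e. e \<in> P \<and> v \<in> e)" for P :: "'v set set" and v
  have ed: "ed P v \<in> P" "v \<in> ed P v" if "P \<in> B" "v \<in> X" for P v
    using theI'[of "\<lambda>e. e \<in> P \<and> v \<in> e"] that unfolding ed_def B_iff by auto
  have ed_eq: "ed P v = e" if "P \<in> B" "e \<in> P" "v \<in> e" for P v e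
  proof -
    have "\<exists>!e. e \<in> P \<and> v \<in> e"
      using that unfolding B_iff by blast
    then show ?thesis
      unfolding ed_def using that by (intro the1_equality) auto
  qed
  have "(\<Sum>\<sigma> \<in> PiE X K. \<Prod>c\<in>C. induced_sum {e \<in> E. cl e = c} {v \<in> X. \<sigma> v = c} wt)
      = (\<Sum>\<sigma> \<in> PiE X K. \<Prod>c\<in>C. \<Sum>P\<in>A \<sigma> c. \<Prod>e\<in>P. wt e)"
    by (simp add: induced_sum_def matching_sum_def A_def)
  \<comment> \<open>Expanding the product over the cells gives a sum over the choices
    \<open>p\<close> of one matching per cell.\<close>
  also have "\<dots> = (\<Sum>\<sigma> \<in> PiE X K. \<Sum>p \<in> PiE C (A \<sigma>). \<Prod>c\<in>C. \<Prod>e\<in>p c. wt e)"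
    using finA \<open>finite C\<close> by (intro sum.cong refl prod_sum_PiE) auto
  also have "\<dots> = (\<Sum>(\<sigma>, p) \<in> Sigma (PiE X K) (\<lambda>\<sigma>. PiE C (A \<sigma>)). \<Prod>c\<in>C. \<Prod>e\<in>p c. wt e)"
    using finA assms by (intro sum.Sigma finite_PiE ballI) auto
  also have "\<dots> = (\<Sum>P\<in>B. \<Prod>e\<in>P. wt e)"
  \<comment> \<open>The pair \<open>(\<sigma>, p)\<close> corresponds to the union of the
    \<open>p c\<close>. Both components are recovered from it: \<open>cl\<close> separates the
    pieces, and the edge covering \<open>v\<close> has class \<open>\<sigma> v\<close>.\<close>
  proof (rule sum.reindex_bij_witness[where
        i = "\<lambda>P. (\<lambda>v\<in>X. cl (ed P v), \<lambda>c\<in>C. {e\<in>P. cl e = c})" and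
        j = "\<lambda>a. \<Union>c\<in>C. snd a c"])
    fix a assume a: "a \<in> Sigma (PiE X K) (\<lambda>\<sigma>. PiE C (A \<sigma>))"
    define \<sigma> p where "\<sigma> = fst a" and "p = snd a"
    have \<sigma>: "\<sigma> \<in> PiE X K" and p: "p \<in> PiE C (A \<sigma>)" and a_eq: "a = (\<sigma>, p)"
      using a by (auto simp: \<sigma>_def p_def)
    have pA: "p c \<in> A \<sigma> c" if "c \<in> C" for c
      using p that by auto
    have pcl: "e \<in> E" "cl e = c" if "c \<in> C" "e \<in> p c" for c e
      using pA[OF that(1)] that unfolding A_iff by auto
    have \<sigma>cl: "\<sigma> v = cl e" "v \<in> X" if "c \<in> C" "e \<in> p c" "v \<in> e" for c e v
      using pA[OF that(1)] that unfolding A_iff by auto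
    have \<sigma>C: "\<sigma> v \<in> C" if "v \<in> X" for v
      using \<sigma> KC[OF that] that by auto
    have inB: "(\<Union>c\<in>C. p c) \<in> B"
      unfolding B_iff
    proof (intro conjI ballI)
      fix v assume v: "v \<in> X"
      then have "\<exists>!e. e \<in> p (\<sigma> v) \<and> v \<in> e"
        using pA[OF \<sigma>C[OF v]] unfolding A_iff by simp
      then obtain e where e: "e \<in> p (\<sigma> v)" "v \<in> e" "\<And>e'. e' \<in> p (\<sigma> v) \<Longrightarrow> v \<in> e' \<Longrightarrow> e' = e"
        by (elim ex1E) blast
      show "\<exists>!e. e \<in> (\<Union>c\<in>C. p c) \<and> v \<in> e"
      proof (rule ex1I[of _ e])
        show "e \<in> (\<Union>c\<in>C. p c) \<and> v \<in> e"
          using e(1,2) \<sigma>C[OF v] by auto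
        fix e' assume "e' \<in> (\<Union>c\<in>C. p c) \<and> v \<in> e'"
        then obtain c where "c \<in> C" "e' \<in> p c" "v \<in> e'" by auto
        \<comment> \<open>All vertices covered by \<open>p c\<close> are assigned to
          \<open>c\<close>, so no other piece covers \<open>v\<close> and uniqueness reduces to a
          single cell.\<close>
        moreover from this have "c = \<sigma> v"
          using pcl(2) \<sigma>cl(1) by metis
        ultimately show "e' = e"
          using e(3) by metis
      qed
    qed (use pcl \<sigma>cl in blast)+
    then show "(\<Union>c\<in>C. snd a c) \<in> B"
      by (simp add: a_eq)
    have *: "cl (ed (\<Union>c\<in>C. p c) v) = \<sigma> v" if "v \<in> X" for v
      using ed[OF inB that] \<sigma>cl(1) by fastforce
    have "(\<lambda>v\<in>X. cl (ed (\<Union>c\<in>C. p c) v)) = \<sigma>"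
      using * \<sigma> by (auto simp: fun_eq_iff restrict_def PiE_def extensional_def)
    moreover have "(\<lambda>c\<in>C. {e \<in> (\<Union>c\<in>C. p c). cl e = c}) = p"
      using p pcl by (fastforce simp: fun_eq_iff restrict_def PiE_def extensional_def)
    ultimately show "(\<lambda>v\<in>X. cl (ed (\<Union>c\<in>C. snd a c) v),
      \<lambda>c\<in>C. {e \<in> (\<Union>c\<in>C. snd a c). cl e = c}) = a"
      by (simp add: a_eq)
    have "(\<Prod>e\<in>(\<Union>c\<in>C. p c). wt e) = (\<Prod>c\<in>C. \<Prod>e\<in>p c. wt e)"
    proof (rule prod.UNION_disjoint)
      show "\<forall>c\<in>C. finite (p c)"
        using pcl(1) \<open>finite E\<close> by (meson finite_subset subsetI)
      show "\<forall>c\<in>C. \<forall>c'\<in>C. c \<noteq> c' \<longrightarrow> p c \<inter> p c' = {}"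
        using pcl(2) by blast
    qed fact
    then show "(\<Prod>e\<in>(\<Union>c\<in>C. snd a c). wt e) =
      (case a of (\<sigma>, p) \<Rightarrow> \<Prod>c\<in>C. \<Prod>e\<in>p c. wt e)"
      by (simp add: a_eq)
  next
    fix P assume P: "P \<in> B"
    then have PE: "P \<subseteq> E"
      unfolding B_iff by auto
    show "(\<Union>c\<in>C. snd (\<lambda>v\<in>X. cl (ed P v), \<lambda>c\<in>C. {e \<in> P. cl e = c}) c) = P"
      using PE cl by auto
    have "(\<lambda>v\<in>X. cl (ed P v)) \<in> PiE X K"
      using ed[OF P] K PE by (auto dest!: subsetD)
    moreover have "{e \<in> P. cl e = c} \<in> A (\<lambda>v\<in>X. cl (ed P v)) c" for c
      unfolding A_iff
    proof (intro conjI ballI)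
      fix v assume "v \<in> {v \<in> X. (\<lambda>v\<in>X. cl (ed P v)) v = c}"
      then show "\<exists>!e. e \<in> {e \<in> P. cl e = c} \<and> v \<in> e"
        using ed[OF P] ed_eq[OF P] by (intro ex1I[of _ "ed P v"]) auto
    qed (use P PE ed_eq[OF P] in \<open>auto simp: B_iff\<close>)
    ultimately show "(\<lambda>v\<in>X. cl (ed P v), \<lambda>c\<in>C. {e \<in> P. cl e = c}) \<in>
      Sigma (PiE X K) (\<lambda>\<sigma>. PiE C (A \<sigma>))"
      by auto
  qed
  finally show ?thesis
    by (simp add: induced_sum_def matching_sum_def B_def)
qed

section \<open>Gauge factors and relabelling of vertices\<close>

text \<open>Each vertex lies in exactly one edge of a perfect matching, so the factors
  \<open>h v\<close> collected along the edges multiply to the same product for every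
  matching.\<close>

lemma matching_sum_gauge:
  fixes wt :: "'v set \<Rightarrow> 'a :: comm_semiring_1"
  assumes "finite X" and EX: "\<And>e. e \<in> E \<Longrightarrow> e \<subseteq> X"
  shows "matching_sum (X, E) (\<lambda>e. (\<Prod>v\<in>e. h v) * wt e) = (\<Prod>v\<in>X. h v) * matching_sum (X, E) wt"
proof -
  have "(\<Prod>e\<in>P. \<Prod>v\<in>e. h v) = (\<Prod>v\<in>X. h v)" if "P \<in> perfect_matchings (X, E)" for P
  proof -
    have P: "\<exists>!e. e \<in> P \<and> v \<in> e" if "v \<in> X" for v
      using \<open>P \<in> _\<close> that by (simp add: perfect_matchings_def)
    have PX: "P \<subseteq> Pow X"
      using \<open>P \<in> _\<close> EX by (auto simp: perfect_matchings_def)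
    have "X = (\<Union>e\<in>P. e)"
    proof
      show "X \<subseteq> (\<Union>e\<in>P. e)"
        using P[THEN ex1_implies_ex] by auto
    qed (use PX in auto)
    moreover have "(\<Prod>v\<in>(\<Union>e\<in>P. e). h v) = (\<Prod>e\<in>P. \<Prod>v\<in>e. h v)"
    proof (rule prod.UNION_disjoint)
      show "finite P" "\<forall>e\<in>P. finite e"
        using \<open>finite X\<close> PX by (auto intro: finite_subset)
      have "e = e'" if "e \<in> P" "e' \<in> P" "v \<in> e" "v \<in> e'" for e e' v
        using P[of v] PX that by (metis PowD subsetD)
      then show "\<forall>e\<in>P. \<forall>e'\<in>P. e \<noteq> e' \<longrightarrow> e \<inter> e' = {}"
        by auto
    qed
    ultimately show ?thesis
      by simp
  qed
  then show ?thesis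
    by (simp add: matching_sum_def prod.distrib sum_distrib_left)
qed

lemma matching_sum_cong:
  assumes "\<And>e. e \<in> snd G \<Longrightarrow> wt e = wt' e"
  shows "matching_sum G wt = matching_sum G wt'"
proof -
  have "wt e = wt' e" if "P \<in> perfect_matchings G" "e \<in> P" for P e
    using that assms by (auto simp: perfect_matchings_def)
  then show ?thesis
    unfolding matching_sum_def by (meson prod.cong sum.cong)
qed

lemma ex1_image_iff:
  assumes "inj f"
  shows "(\<exists>!y. y \<in> f ` A \<and> Q y) \<longleftrightarrow> (\<exists>!x. x \<in> A \<and> Q (f x))"
proof
  assume *: "\<exists>!y. y \<in> f ` A \<and> Q y"
  then obtain y where y: "y \<in> f ` A \<and> Q y"
    by (rule ex1_implies_ex[THEN exE])
  then obtain x where x: "x \<in> A" "y = f x"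
    by blast
  show "\<exists>!x. x \<in> A \<and> Q (f x)"
  proof (rule ex1I[of _ x])
    show "x \<in> A \<and> Q (f x)"
      using x y by simp
    show "x' = x" if "x' \<in> A \<and> Q (f x')" for x'
    proof -
      have "f x' \<in> f ` A \<and> Q (f x')"
        using that by simp
      then have "f x' = f x"
        using the1_equality[OF * y] the1_equality[OF *] x(2) by metis
      with assms show ?thesis
        by (rule injD)
    qed
  qed
next
  assume *: "\<exists>!x. x \<in> A \<and> Q (f x)"
  then obtain x where x: "x \<in> A \<and> Q (f x)"
    by (rule ex1_implies_ex[THEN exE])
  show "\<exists>!y. y \<in> f ` A \<and> Q y"
  proof (rule ex1I[of _ "f x"])
    show "y = f x" if y: "y \<in> f ` A \<and> Q y" for y
    proof -
      obtain x' where x': "y = f x'" "x' \<in> A"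
        using y by blast
      then show ?thesis
        using the1_equality[OF * x] the1_equality[OF *, of x'] y by simp
    qed
  qed (use x in simp)
qed

text \<open>An injective relabelling is also injective on edges and on sets of edges, hence maps
  perfect matchings bijectively to perfect matchings.\<close>

lemma matching_sum_image:
  assumes "inj \<phi>"
  shows "matching_sum (\<phi> ` X, (`) \<phi> ` E) wt = matching_sum (X, E) (\<lambda>e. wt (\<phi> ` e))"
proof -
  have inj: "inj ((`) \<phi>)" "inj ((`) ((`) \<phi>))"
    using assms by (simp_all add: inj_image_eq_iff inj_def[of "(`) _"])
  have iff: "(`) \<phi> ` P \<in> perfect_matchings (\<phi> ` X, (`) \<phi> ` E) \<longleftrightarrow> P \<in> perfect_matchings (X, E)" for P
  proof -
    have "(\<exists>!e. e \<in> (`) \<phi> ` P \<and> \<phi> v \<in> e) \<longleftrightarrow> (\<exists>!e. e \<in> P \<and> \<phi> v \<in> \<phi> ` e)" for v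
      by (rule ex1_image_iff[OF inj(1)])
    then have "(\<exists>!e. e \<in> (`) \<phi> ` P \<and> \<phi> v \<in> e) \<longleftrightarrow> (\<exists>!e. e \<in> P \<and> v \<in> e)" for v
      using assms by (simp add: inj_image_mem_iff)
    then show ?thesis
      using inj(1) by (simp add: perfect_matchings_def inj_image_subset_iff)
  qed
  have "perfect_matchings (\<phi> ` X, (`) \<phi> ` E) = (`) ((`) \<phi>) ` perfect_matchings (X, E)"
  proof (intro set_eqI iffI)
    fix P assume P: "P \<in> perfect_matchings (\<phi> ` X, (`) \<phi> ` E)"
    then obtain P' where "P = (`) \<phi> ` P'"
      by (auto simp: perfect_matchings_def subset_image_iff)
    with P iff show "P \<in> (`) ((`) \<phi>) ` perfect_matchings (X, E)"
      by auto
  qed (use iff in auto)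
  then show ?thesis
    using inj by (simp add: matching_sum_def sum.reindex prod.reindex inj_on_subset[OF _ subset_UNIV] o_def)
qed

text \<open>Substitute \<open>oth v (\<sigma> v)\<close> for \<open>\<sigma> v\<close> on
  \<open>X'\<close>. A vertex of \<open>X'\<close> that may go to \<open>c\<close> lies in exactly
  one of the old and the new fibre over \<open>c\<close>; a vertex outside \<open>X'\<close> has no
  choice and lies in the old fibre only. So the old fibre is the complement of the new one among the
  vertices of \<open>c\<close>.\<close>

lemma sum_PiE_complement:
  fixes g :: "'c \<Rightarrow> 'v set \<Rightarrow> 'a :: comm_semiring_1"
  assumes "X' \<subseteq> X"
    and oth: "\<And>v c. v \<in> X' \<Longrightarrow> c \<in> K v \<Longrightarrow>
      oth v c \<noteq> c \<and> oth v (oth v c) = c \<and> K v = {c, oth v c}"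
    and bd: "\<And>v. v \<in> X - X' \<Longrightarrow> K v = {bd v}"
  shows "(\<Sum>\<sigma> \<in> PiE X K. \<Prod>c\<in>C. g c {v \<in> X. \<sigma> v = c}) =
    (\<Sum>\<sigma> \<in> PiE X' K. \<Prod>c\<in>C. g c ({v \<in> X. c \<in> K v} - {v \<in> X'. \<sigma> v = c}))"
\<comment> \<open>Backwards, vertices outside \<open>X'\<close> regain their forced value
  \<open>bd v\<close>; on \<open>X'\<close> the substitution is an involution.\<close>
proof (rule sum.reindex_bij_witness[where
      j = "\<lambda>\<sigma>. \<lambda>v\<in>X'. oth v (\<sigma> v)" and
      i = "\<lambda>\<sigma>. \<lambda>v\<in>X. if v \<in> X' then oth v (\<sigma> v) else bd v"])
  fix \<sigma> assume \<sigma>: "\<sigma> \<in> PiE X K"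
  have \<sigma>K: "\<sigma> v \<in> K v" if "v \<in> X" for v
    using \<sigma> that by auto
  show "(\<lambda>v\<in>X'. oth v (\<sigma> v)) \<in> PiE X' K"
  proof (intro restrict_PiE_iff[THEN iffD2] ballI)
    fix v assume "v \<in> X'"
    then show "oth v (\<sigma> v) \<in> K v"
      using oth[of v "\<sigma> v"] \<sigma>K[of v] \<open>X' \<subseteq> X\<close> by auto
  qed
  show "(\<lambda>v\<in>X. if v \<in> X' then oth v ((\<lambda>v\<in>X'. oth v (\<sigma> v)) v) else bd v) = \<sigma>"
  proof
    fix v
    show "(\<lambda>v\<in>X. if v \<in> X' then oth v ((\<lambda>v\<in>X'. oth v (\<sigma> v)) v) else bd v) v = \<sigma> v"
      using \<sigma> oth[of v "\<sigma> v"] bd[of v] \<sigma>K[of v] by (auto simp: PiE_def extensional_def)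
  qed
  have "{v \<in> X. c \<in> K v} - {v \<in> X'. (\<lambda>v\<in>X'. oth v (\<sigma> v)) v = c} = {v \<in> X. \<sigma> v = c}" for c
  proof (intro set_eqI)
    fix v
    show "v \<in> {v \<in> X. c \<in> K v} - {v \<in> X'. (\<lambda>v\<in>X'. oth v (\<sigma> v)) v = c} \<longleftrightarrow> v \<in> {v \<in> X. \<sigma> v = c}"
      using oth[of v "\<sigma> v"] bd[of v] \<sigma>K[of v] \<open>X' \<subseteq> X\<close> by (cases "v \<in> X'"; cases "v \<in> X") auto
  qed
  then show "(\<Prod>c\<in>C. g c ({v \<in> X. c \<in> K v} - {v \<in> X'. (\<lambda>v\<in>X'. oth v (\<sigma> v)) v = c})) =
    (\<Prod>c\<in>C. g c {v \<in> X. \<sigma> v = c})"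
    by simp
next
  fix \<sigma> assume \<sigma>: "\<sigma> \<in> PiE X' K"
  have \<sigma>K: "\<sigma> v \<in> K v" if "v \<in> X'" for v
    using \<sigma> that by auto
  show "(\<lambda>v\<in>X. if v \<in> X' then oth v (\<sigma> v) else bd v) \<in> PiE X K"
  proof (intro restrict_PiE_iff[THEN iffD2] ballI)
    fix v assume "v \<in> X"
    then show "(if v \<in> X' then oth v (\<sigma> v) else bd v) \<in> K v"
      using oth[of v "\<sigma> v"] bd[of v] \<sigma>K[of v] by auto
  qed
  show "(\<lambda>v\<in>X'. oth v ((\<lambda>v\<in>X. if v \<in> X' then oth v (\<sigma> v) else bd v) v)) = \<sigma>"
  proof
    fix v
    show "(\<lambda>v\<in>X'. oth v ((\<lambda>v\<in>X. if v \<in> X' then oth v (\<sigma> v) else bd v) v)) v = \<sigma> v"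
      using \<sigma> oth[of v "\<sigma> v"] \<sigma>K[of v] \<open>X' \<subseteq> X\<close> by (auto simp: PiE_def extensional_def)
  qed
qed


section \<open>A single edge, and vertex sets without perfect matchings\<close>

lemma matching_sum_edge: "matching_sum ({a, b}, {{a, b}}) wt = wt {a, b}"
proof -
  have "perfect_matchings ({a, b}, {{a, b}}) = {{{a, b}}}"
    by (auto simp: perfect_matchings_def subset_singleton_iff)
  then show ?thesis
    by (simp add: matching_sum_def)
qed

lemma induced_sum_eq_0:
  assumes "\<And>P. P \<subseteq> E \<Longrightarrow> \<forall>e\<in>P. e \<subseteq> Q \<Longrightarrow> \<forall>v\<in>Q. \<exists>!e. e \<in> P \<and> v \<in> e \<Longrightarrow> False"
  shows "induced_sum E Q wt = 0"
proof -
  have "perfect_matchings (Q, {e \<in> E. e \<subseteq> Q}) = {}"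
    using assms unfolding set_eq_iff perfect_matchings_induced_iff by blast
  then show ?thesis
    by (simp add: induced_sum_def matching_sum_def)
qed

lemma induced_sum_isolated:
  assumes "z \<in> Q" "\<And>e. e \<in> E \<Longrightarrow> e \<subseteq> Q \<Longrightarrow> z \<notin> e"
  shows "induced_sum E Q wt = 0"
  using assms by (intro induced_sum_eq_0) (meson subsetD)

text \<open>Both \<open>a\<close> and \<open>b\<close> can only be matched to \<open>c\<close>,
  which would then be covered twice. This excludes the three-element subsets of a
  four-cycle.\<close>

lemma induced_sum_cherry:
  assumes "a \<in> Q" "b \<in> Q" "c \<in> Q" "a \<noteq> b" "a \<noteq> c" "b \<noteq> c"
    and a: "\<And>e. e \<in> E \<Longrightarrow> e \<subseteq> Q \<Longrightarrow> a \<in> e \<Longrightarrow> e = {a, c}"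
    and b: "\<And>e. e \<in> E \<Longrightarrow> e \<subseteq> Q \<Longrightarrow> b \<in> e \<Longrightarrow> e = {b, c}"
  shows "induced_sum E Q wt = 0"
proof (rule induced_sum_eq_0)
  fix P assume P: "P \<subseteq> E" "\<forall>e\<in>P. e \<subseteq> Q" "\<forall>v\<in>Q. \<exists>!e. e \<in> P \<and> v \<in> e"
  have "{a, c} \<in> P"
    using P(3)[rule_format, OF \<open>a \<in> Q\<close>] P(1,2) a by (metis subsetD)
  moreover have "{b, c} \<in> P"
    using P(3)[rule_format, OF \<open>b \<in> Q\<close>] P(1,2) b by (metis subsetD)
  moreover have "{a, c} \<noteq> {b, c}"
    using \<open>a \<noteq> b\<close> \<open>a \<noteq> c\<close> by (simp add: doubleton_eq_iff)
  ultimately show False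
    using P(3)[rule_format, OF \<open>c \<in> Q\<close>] by (metis insertCI)
qed

lemma ex1_doubleton:
  assumes "x \<in> e \<union> e'" "e \<inter> e' = {}"
  shows "\<exists>!f. f \<in> {e, e'} \<and> x \<in> f"
proof (cases "x \<in> e")
  case True
  then show ?thesis
    using assms by (intro ex1I[of _ e]) auto
next
  case False
  then show ?thesis
    using assms by (intro ex1I[of _ e']) auto
qed

section \<open>Four-cycles\<close>

text \<open>The sides are \<open>u, u'\<close> and \<open>v, v'\<close>. Each of
  \<open>u, u'\<close> is covered by one of its two edges, and edges sharing a vertex exclude each
  other, which leaves the two pairs of opposite edges.\<close>

lemma perfect_matchings_four_cycle:
  assumes "distinct [u, u', v, v']"
  shows "perfect_matchings ({u, u', v, v'}, {{u, v}, {u, v'}, {u', v}, {u', v'}}) =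
    {{{u, v}, {u', v'}}, {{u, v'}, {u', v}}}" (is "?M = ?R")
proof (intro set_eqI iffI)
  fix P assume "P \<in> ?M"
  then have P: "P \<subseteq> {{u, v}, {u, v'}, {u', v}, {u', v'}}"
    by (simp add: perfect_matchings_def)
  have "\<forall>x\<in>{u, u', v, v'}. \<exists>!e. e \<in> P \<and> x \<in> e"
    using \<open>P \<in> ?M\<close> unfolding perfect_matchings_def mem_Collect_eq fst_conv by (rule conjunct2)
  then have U: "\<exists>!e. e \<in> P \<and> x \<in> e" if "x \<in> {u, u', v, v'}" for x
    using that by (rule bspec)
  have ne: "{u, v} \<noteq> {u, v'}" "{u', v} \<noteq> {u', v'}" "{u, v} \<noteq> {u', v}" "{u, v'} \<noteq> {u', v'}"
    using assms by (auto simp: doubleton_eq_iff)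
  have uq: "e = e'" if "e \<in> P" "e' \<in> P" "x \<in> e" "x \<in> e'" "x \<in> {u, u', v, v'}" for e e' x
    using the1_equality[OF U[OF that(5)], of e] the1_equality[OF U[OF that(5)], of e'] that(1-4)
    by simp
  have "{u, v} \<in> P \<or> {u, v'} \<in> P"
  proof -
    obtain e where "e \<in> P" "u \<in> e"
      using ex1_implies_ex[OF U[of u]] by auto
    moreover from this have "e \<in> {{u, v}, {u, v'}, {u', v}, {u', v'}}"
      using P by blast
    ultimately show ?thesis
      using assms by auto
  qed
  moreover have "{u', v} \<in> P \<or> {u', v'} \<in> P"
  proof -
    obtain e where "e \<in> P" "u' \<in> e"
      using ex1_implies_ex[OF U[of u']] by auto
    moreover from this have "e \<in> {{u, v}, {u, v'}, {u', v}, {u', v'}}"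
      using P by blast
    ultimately show ?thesis
      using assms by auto
  qed
  moreover have "\<not> ({u, v} \<in> P \<and> {u, v'} \<in> P)" "\<not> ({u', v} \<in> P \<and> {u', v'} \<in> P)"
    "\<not> ({u, v} \<in> P \<and> {u', v} \<in> P)" "\<not> ({u, v'} \<in> P \<and> {u', v'} \<in> P)"
    using uq[of "{u, v}" "{u, v'}" u] uq[of "{u', v}" "{u', v'}" u']
      uq[of "{u, v}" "{u', v}" v] uq[of "{u, v'}" "{u', v'}" v'] ne by auto
  ultimately have "({u, v} \<in> P \<and> {u', v'} \<in> P \<and> {u, v'} \<notin> P \<and> {u', v} \<notin> P) \<or>
      ({u, v} \<notin> P \<and> {u', v'} \<notin> P \<and> {u, v'} \<in> P \<and> {u', v} \<in> P)"
    by argo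
  then show "P \<in> ?R"
  proof
    assume *: "{u, v} \<in> P \<and> {u', v'} \<in> P \<and> {u, v'} \<notin> P \<and> {u', v} \<notin> P"
    have "P = {{u, v}, {u', v'}}"
    proof
      show "P \<subseteq> {{u, v}, {u', v'}}"
      proof
        fix e assume "e \<in> P"
        then show "e \<in> {{u, v}, {u', v'}}"
          using subsetD[OF P \<open>e \<in> P\<close>] * by (elim insertE) simp_all
      qed
    qed (use * in simp)
    then show ?thesis
      by simp
  next
    assume *: "{u, v} \<notin> P \<and> {u', v'} \<notin> P \<and> {u, v'} \<in> P \<and> {u', v} \<in> P"
    have "P = {{u, v'}, {u', v}}"
    proof
      show "P \<subseteq> {{u, v'}, {u', v}}"
      proof
        fix e assume "e \<in> P"
        then show "e \<in> {{u, v'}, {u', v}}"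
          using subsetD[OF P \<open>e \<in> P\<close>] * by (elim insertE) simp_all
      qed
    qed (use * in simp)
    then show ?thesis
      by simp
  qed
next
  fix P assume "P \<in> ?R"
  then consider "P = {{u, v}, {u', v'}}" | "P = {{u, v'}, {u', v}}"
    by auto
  then show "P \<in> ?M"
  proof cases
    case 1
    have "\<exists>!e. e \<in> {{u, v}, {u', v'}} \<and> x \<in> e" if "x \<in> {u, u', v, v'}" for x
      using that assms by (intro ex1_doubleton) auto
    then show ?thesis
      unfolding 1 by (simp add: perfect_matchings_def)
  next
    case 2
    have "\<exists>!e. e \<in> {{u, v'}, {u', v}} \<and> x \<in> e" if "x \<in> {u, u', v, v'}" for x
      using that assms by (intro ex1_doubleton) auto
    then show ?thesis
      unfolding 2 by (simp add: perfect_matchings_def)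
  qed
qed

lemma induced_sum_empty:
  assumes "{} \<notin> E"
  shows "induced_sum E {} wt = 1"
proof -
  have "perfect_matchings ({}, {e \<in> E. e \<subseteq> {}}) = {{}}"
    using assms by (auto simp: perfect_matchings_def)
  then show ?thesis
    by (simp add: induced_sum_def matching_sum_def)
qed

lemma induced_sum_four_cycle_full:
  assumes "distinct [u, u', v, v']"
  shows "induced_sum {{u, v}, {u, v'}, {u', v}, {u', v'}} {u, u', v, v'} wt =
    wt {u, v} * wt {u', v'} + wt {u, v'} * wt {u', v}"
proof -
  have E: "{e \<in> {{u, v}, {u, v'}, {u', v}, {u', v'}}. e \<subseteq> {u, u', v, v'}} =
      {{u, v}, {u, v'}, {u', v}, {u', v'}}"
    by auto
  have "{{u, v}, {u', v'}} \<noteq> {{u, v'}, {u', v}}" "{u, v} \<noteq> {u', v'}" "{u, v'} \<noteq> {u', v}"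
    using assms by (simp_all add: doubleton_eq_iff)
  then show ?thesis
    unfolding induced_sum_def E matching_sum_def perfect_matchings_four_cycle[OF assms] by simp
qed

lemma induced_sum_four_cycle_edge:
  assumes "distinct [u, u', v, v']" and Q: "Q \<in> {{u, v}, {u, v'}, {u', v}, {u', v'}}"
  shows "induced_sum {{u, v}, {u, v'}, {u', v}, {u', v'}} Q wt = wt Q"
proof -
  have "{e \<in> {{u, v}, {u, v'}, {u', v}, {u', v'}}. e \<subseteq> Q} = {Q}"
    using assms by auto
  moreover obtain a b where "Q = {a, b}"
    using Q by blast
  ultimately show ?thesis
    by (simp add: induced_sum_def matching_sum_edge)
qed

lemma subset_doubleton_cases:
  assumes "A \<subseteq> {a, b}"
  shows "A = {} \<or> A = {a} \<or> A = {b} \<or> A = {a, b}"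
  using assms by (cases "a \<in> A"; cases "b \<in> A") auto

text \<open>Such a \<open>Q\<close> either lies in one side of the bipartition and has only isolated
  vertices, or it has three vertices, two of which compete for the third.\<close>

lemma induced_sum_four_cycle_other:
  assumes dist: "distinct [u, u', v, v']" and Q: "Q \<subseteq> {u, u', v, v'}" "Q \<noteq> {}" "Q \<noteq> {u, u', v, v'}"
    and QE: "Q \<notin> {{u, v}, {u, v'}, {u', v}, {u', v'}}"
  shows "induced_sum {{u, v}, {u, v'}, {u', v}, {u', v'}} Q wt = 0" (is "induced_sum ?E Q wt = 0")
proof -
  have "Q \<inter> {u, u'} \<subseteq> {u, u'}" "Q \<inter> {v, v'} \<subseteq> {v, v'}"
    by simp_all
  moreover have "Q = Q \<inter> {u, u'} \<union> Q \<inter> {v, v'}"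
    using Q(1) by blast
  ultimately obtain A B where AB: "A \<subseteq> {u, u'}" "B \<subseteq> {v, v'}" "Q = A \<union> B"
    by metis
  consider "A = {}" | "B = {}" | "A = {u, u'}" "B = {v}" | "A = {u, u'}" "B = {v'}"
    | "A = {u}" "B = {v, v'}" | "A = {u'}" "B = {v, v'}"
    using subset_doubleton_cases[OF AB(1)] subset_doubleton_cases[OF AB(2)] Q(2,3) QE
    unfolding AB(3) by (elim disjE) (simp_all add: insert_commute)
  then show ?thesis
  proof cases
    case 1
    obtain z where "z \<in> Q"
      using Q by blast
    then show ?thesis
      using 1 AB dist by (intro induced_sum_isolated[of z]) auto
  next
    case 2
    obtain z where "z \<in> Q"
      using Q by blast
    then show ?thesis
      using 2 AB dist by (intro induced_sum_isolated[of z]) auto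
  next
    case 3
    show ?thesis
      by (rule induced_sum_cherry[of u _ u' v]) (use 3 AB dist in auto)
  next
    case 4
    show ?thesis
      by (rule induced_sum_cherry[of u _ u' v']) (use 4 AB dist in auto)
  next
    case 5
    show ?thesis
      by (rule induced_sum_cherry[of v _ v' u]) (use 5 AB dist in auto)
  next
    case 6
    show ?thesis
      by (rule induced_sum_cherry[of v _ v' u']) (use 6 AB dist in auto)
  qed
qed

text \<open>The local identity behind the reduction. For \<open>R\<close> empty or full, one side is
  an empty matching and the other the sum over both perfect matchings; the complement of an edge is
  the opposite edge; for all other \<open>R\<close> both sides vanish.\<close>

lemma induced_sum_four_cycle_complement:
  fixes wt wt' :: "'v set \<Rightarrow> 'a :: field"
  assumes dist: "distinct [u, u', v, v']" and R: "R \<subseteq> {u, u', v, v'}"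
    and \<Delta>: "\<Delta> = wt {u, v} * wt {u', v'} + wt {u, v'} * wt {u', v}" "\<Delta> \<noteq> 0"
    and wt': "wt' {u, v} = wt {u', v'} / \<Delta>" "wt' {u', v'} = wt {u, v} / \<Delta>"
      "wt' {u, v'} = wt {u', v} / \<Delta>" "wt' {u', v} = wt {u, v'} / \<Delta>"
  shows "induced_sum {{u, v}, {u, v'}, {u', v}, {u', v'}} ({u, u', v, v'} - R) wt =
    \<Delta> * induced_sum {{u, v}, {u, v'}, {u', v}, {u', v'}} R wt'"
proof -
  define E where "E = {{u, v}, {u, v'}, {u', v}, {u', v'}}"
  define F where "F = {u, u', v, v'}"
  note full = induced_sum_four_cycle_full[OF dist, folded E_def F_def]
  note edge = induced_sum_four_cycle_edge[OF dist, folded E_def]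
  note other = induced_sum_four_cycle_other[OF dist, folded E_def F_def]
  have "{} \<notin> E"
    by (simp add: E_def)
  note empty = induced_sum_empty[OF this]
  have compl: "F - {u, v} = {u', v'}" "F - {u', v'} = {u, v}"
    "F - {u, v'} = {u', v}" "F - {u', v} = {u, v'}"
    using dist by (auto simp: F_def insert_Diff_if)
  have compl_E: "F - e \<in> E \<and> wt (F - e) = \<Delta> * wt' e" if e: "e \<in> E" for e
  proof -
    consider "e = {u, v}" | "e = {u', v'}" | "e = {u, v'}" | "e = {u', v}"
      using e unfolding E_def by blast
    then show ?thesis
      by cases (simp_all add: compl E_def \<Delta>(2) wt')
  qed
  have RF: "R \<subseteq> F"
    using R by (simp add: F_def)
  have "induced_sum E (F - R) wt = \<Delta> * induced_sum E R wt'"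
  proof (cases "R = {}")
    case True
    then show ?thesis
      by (simp add: full \<Delta>(1) empty)
  next
    case R_ne: False
    show ?thesis
    proof (cases "R = F")
      case True
      \<comment> \<open>Exchanging opposite weights leaves both products unchanged, so the new
        weights give \<open>\<Delta>\<close> divided by its square.\<close>
      have "wt' {u, v} * wt' {u', v'} + wt' {u, v'} * wt' {u', v} = \<Delta> / (\<Delta> * \<Delta>)"
        unfolding wt' by (simp add: \<Delta>(1) add_divide_distrib mult.commute)
      then show ?thesis
        using True \<Delta>(2) by (simp add: full empty)
    next
      case R_nF: False
      show ?thesis
      proof (cases "R \<in> E")
        case True
        then show ?thesis
          using compl_E by (simp add: edge)
      next
        case False
        have "F - (F - R) = R"
          using RF by auto
        \<comment> \<open>\<open>E\<close> is closed under complements in \<open>F\<close>, so the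
          complement of a non-edge is a non-edge.\<close>
        then have "F - R \<notin> E" "F - R \<noteq> F" "F - R \<noteq> {}"
          using False compl_E[of "F - R"] R_ne R_nF RF by auto
        then show ?thesis
          using RF R_ne R_nF False by (simp add: other)
      qed
    qed
  qed
  then show ?thesis
    by (simp only: E_def F_def)
qed

section \<open>Cells of the Aztec diamond\<close>

text \<open>Edge weights given by the position in the array of edge centers; as \<open>eps\<close>
  is injective, \<open>w\<close> is arbitrary here.\<close>

definition on_array :: "(nat \<Rightarrow> nat \<Rightarrow> 'a) \<Rightarrow> vertex set \<Rightarrow> 'a" where
  "on_array w e = (case the_inv (\<lambda>(r, s). eps r s) e of (r, s) \<Rightarrow> w r s)"

lemma on_array_eps [simp]: "on_array w (eps r s) = w r s"
  using the_inv_f_f[OF inj_eps, of "(r, s)"] by (simp add: on_array_def)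

lemma y_weight_on_array:
  "y_weight T = on_array (\<lambda>r s.
    if s mod 4 = 1 then fst (T r)
    else if s mod 4 = 2 then snd (T r)
    else if s mod 4 = 3 then 1 / fst (T r)
    else 1 / snd (T r))"
  by (simp add: y_weight_def on_array_def fun_eq_iff)

text \<open>Exchanges \<open>2*k + 1\<close> and \<open>2*k + 2\<close>. Applied to both row and
  column of an edge it yields the opposite edge of the same cell.\<close>

definition cell_opp :: "nat \<Rightarrow> nat" where
  "cell_opp r = (if odd r then r + 1 else r - 1)"

text \<open>The matching sum of the whole cell \<open>(a, b)\<close>: one product for each pair of
  opposite edges.\<close>

definition cell_weight :: "(nat \<Rightarrow> nat \<Rightarrow> 'a :: semiring) \<Rightarrow> nat \<Rightarrow> nat \<Rightarrow> 'a" where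
  "cell_weight w a b = w (2*a + 1) (2*b + 1) * w (2*a + 2) (2*b + 2) +
    w (2*a + 1) (2*b + 2) * w (2*a + 2) (2*b + 1)"

text \<open>This identifies \<open>AD m\<close> with \<open>AD (Suc m)\<close> without its boundary vertices; the roles of \<open>U\<close> and
  \<open>V\<close> are exchanged.\<close>

fun inner_vertex :: "vertex \<Rightarrow> vertex" where
  "inner_vertex (U i j) = V (i + 1) j"
| "inner_vertex (V i j) = U i (j + 1)"

lemma inj_inner_vertex: "inj inner_vertex"
proof (rule injI)
  show "x = y" if "inner_vertex x = inner_vertex y" for x y
    using that by (cases x; cases y) auto
qed

lemma inner_vertex_eps: "inner_vertex ` eps r s = eps (r + 1) (s + 1)"
  by (auto simp: eps_def)

text \<open>Cell \<open>(a, b)\<close>, counted from \<open>(0, 0)\<close>, consists of the edges in rows \<open>2a+1, 2a+2\<close> and columns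
  \<open>2b+1, 2b+2\<close>. The subtraction in \<open>boundary_cell\<close> is meant to truncate at \<open>0\<close>.\<close>

fun cells_of :: "nat \<Rightarrow> vertex \<Rightarrow> (nat \<times> nat) set" where
  "cells_of n (U i j) = {(a, b). a < n \<and> (a = i \<or> Suc a = i) \<and> Suc b = j}"
| "cells_of n (V i j) = {(a, b). Suc a = i \<and> b < n \<and> (b = j \<or> Suc b = j)}"

text \<open>The two cells of an inner vertex \<open>U i j\<close> have first indices
  \<open>i - 1\<close> and \<open>i\<close>, which add up to \<open>2 * i - 1\<close>; likewise for
  \<open>V i j\<close> with the second indices.\<close>

fun other_cell :: "vertex \<Rightarrow> nat \<times> nat \<Rightarrow> nat \<times> nat" where
  "other_cell (U i j) (a, b) = (2 * i - 1 - a, b)"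
| "other_cell (V i j) (a, b) = (a, 2 * j - 1 - b)"

fun boundary_cell :: "vertex \<Rightarrow> nat \<times> nat" where
  "boundary_cell (U i j) = (i - 1, j - 1)"
| "boundary_cell (V i j) = (i - 1, j - 1)"

section \<open>Vertices and edges of the diamond and of its cells\<close>

lemma U_in_AD [simp]: "U i j \<in> fst (AD n) \<longleftrightarrow> i \<le> n \<and> 1 \<le> j \<and> j \<le> n"
  by (auto simp: AD_def)

lemma V_in_AD [simp]: "V i j \<in> fst (AD n) \<longleftrightarrow> 1 \<le> i \<and> i \<le> n \<and> j \<le> n"
  by (auto simp: AD_def)

lemma snd_AD: "snd (AD n) = {eps r s | r s. r \<in> {1..2*n} \<and> s \<in> {1..2*n}}"
  by (simp add: AD_def)

lemma eps_in_AD: "r \<in> {1..2*n} \<Longrightarrow> s \<in> {1..2*n} \<Longrightarrow> eps r s \<in> snd (AD n)"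
  unfolding snd_AD by blast

lemma edge_of_AD:
  assumes "e \<in> snd (AD n)"
  obtains r s where "e = eps r s" "r \<in> {1..2*n}" "s \<in> {1..2*n}"
  using assms unfolding snd_AD by blast

lemma fst_AD_eq: "fst (AD n) = (\<lambda>(i, j). U i j) ` ({..n} \<times> {1..n}) \<union> (\<lambda>(i, j). V i j) ` ({1..n} \<times> {..n})"
  by (auto simp: AD_def)

lemma finite_AD: "finite (fst (AD n))" "finite (snd (AD n))"
proof -
  show "finite (fst (AD n))"
    unfolding fst_AD_eq by simp
  have "snd (AD n) \<subseteq> (\<lambda>(r, s). eps r s) ` ({1..2*n} \<times> {1..2*n})"
    by (auto simp: snd_AD)
  then show "finite (snd (AD n))"
    by (rule finite_subset) simp
qed

lemma edge_subset_AD: "e \<in> snd (AD n) \<Longrightarrow> e \<subseteq> fst (AD n)"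
  by (auto simp: snd_AD eps_def)

lemma eps_cell:
  "eps (2*a + 1) (2*b + 1) = {U a (Suc b), V (Suc a) b}"
  "eps (2*a + 1) (2*b + 2) = {U a (Suc b), V (Suc a) (Suc b)}"
  "eps (2*a + 2) (2*b + 1) = {U (Suc a) (Suc b), V (Suc a) b}"
  "eps (2*a + 2) (2*b + 2) = {U (Suc a) (Suc b), V (Suc a) (Suc b)}"
  by (simp_all add: eps_def)

definition cell_of_edge :: "vertex set \<Rightarrow> nat \<times> nat" where
  "cell_of_edge = on_array (\<lambda>r s. ((r - 1) div 2, (s - 1) div 2))"

text \<open>Listed as in the four-cycle lemmas, with \<open>u = U a (Suc b)\<close>,
  \<open>u' = U (Suc a) (Suc b)\<close>, \<open>v = V (Suc a) b\<close> and
  \<open>v' = V (Suc a) (Suc b)\<close>.\<close>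

lemma edges_of_cell:
  assumes "a < n" "b < n"
  shows "{e \<in> snd (AD n). cell_of_edge e = (a, b)} =
    {{U a (Suc b), V (Suc a) b}, {U a (Suc b), V (Suc a) (Suc b)},
     {U (Suc a) (Suc b), V (Suc a) b}, {U (Suc a) (Suc b), V (Suc a) (Suc b)}}" (is "?L = ?R")
proof
  show "?L \<subseteq> ?R"
  proof
    fix e assume "e \<in> ?L"
    then have "e \<in> snd (AD n)"
      by blast
    then obtain r s where rs: "e = eps r s" "r \<in> {1..2*n}" "s \<in> {1..2*n}"
      by (rule edge_of_AD)
    moreover from this have "(r - 1) div 2 = a" "(s - 1) div 2 = b"
      using \<open>e \<in> ?L\<close> by (simp_all add: cell_of_edge_def)
    ultimately have "r = 2*a + 1 \<or> r = 2*a + 2" "s = 2*b + 1 \<or> s = 2*b + 2"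
      unfolding atLeastAtMost_iff by linarith+
    then show "e \<in> ?R"
      unfolding rs(1) by (elim disjE) (simp_all only: eps_cell insert_iff simp_thms)
  qed
  have "eps r s \<in> ?L" if "r \<in> {2*a + 1, 2*a + 2}" "s \<in> {2*b + 1, 2*b + 2}" for r s
  proof -
    have "r \<in> {1..2*n}" "s \<in> {1..2*n}"
      using that assms by auto
    moreover have "(r - 1) div 2 = a" "(s - 1) div 2 = b"
      using that by auto
    ultimately show ?thesis
      by (simp add: eps_in_AD cell_of_edge_def)
  qed
  then show "?R \<subseteq> ?L"
    unfolding eps_cell[symmetric] by blast
qed

lemma cells_of_subset: "v \<in> fst (AD n) \<Longrightarrow> cells_of n v \<subseteq> {..<n} \<times> {..<n}"
  by (cases v) auto

lemma cell_of_edge_in_cells_of: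
  assumes "e \<in> snd (AD n)" "v \<in> e"
  shows "cell_of_edge e \<in> cells_of n v"
proof -
  obtain r s where rs: "e = eps r s" "r \<in> {1..2*n}" "s \<in> {1..2*n}"
    using assms(1) by (rule edge_of_AD)
  define a b where "a = (r - 1) div 2" and "b = (s - 1) div 2"
  have *: "a < n" "b < n" "a = r div 2 \<or> Suc a = r div 2" "b = s div 2 \<or> Suc b = s div 2"
    "(r + 1) div 2 = Suc a" "(s + 1) div 2 = Suc b"
    using rs unfolding atLeastAtMost_iff a_def b_def by linarith+
  have "v = U (r div 2) (Suc b) \<or> v = V (Suc a) (s div 2)"
    using assms(2) unfolding rs(1) eps_def * by simp
  moreover have "cell_of_edge e = (a, b)"
    by (simp add: rs(1) cell_of_edge_def a_def b_def)
  ultimately show ?thesis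
    using *(1-4) by (elim disjE) simp_all
qed

lemma vertices_of_cell:
  assumes "a < n" "b < n"
  shows "{v \<in> fst (AD n). (a, b) \<in> cells_of n v} =
    {U a (Suc b), U (Suc a) (Suc b), V (Suc a) b, V (Suc a) (Suc b)}"
proof (intro set_eqI)
  fix v
  show "v \<in> {v \<in> fst (AD n). (a, b) \<in> cells_of n v} \<longleftrightarrow>
    v \<in> {U a (Suc b), U (Suc a) (Suc b), V (Suc a) b, V (Suc a) (Suc b)}"
    using assms by (cases v) auto
qed

section \<open>The inner vertices as a diamond of the next lower order\<close>

text \<open>Compared with \<open>AD (Suc m)\<close>, exactly the vertices \<open>U i j\<close> with
  \<open>i = 0\<close> or \<open>i = Suc m\<close> are missing; these lie in one cell only.\<close>

lemma U_in_inner_AD: "U i j \<in> inner_vertex ` fst (AD m) \<longleftrightarrow> 1 \<le> i \<and> i \<le> m \<and> 1 \<le> j \<and> j \<le> Suc m"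
proof -
  have "U i j \<in> inner_vertex ` fst (AD m) \<longleftrightarrow> 1 \<le> j \<and> V i (j - 1) \<in> fst (AD m)"
  proof
    assume "U i j \<in> inner_vertex ` fst (AD m)"
    then obtain v where "v \<in> fst (AD m)" "U i j = inner_vertex v"
      by blast
    then show "1 \<le> j \<and> V i (j - 1) \<in> fst (AD m)"
      by (cases v) auto
  next
    assume *: "1 \<le> j \<and> V i (j - 1) \<in> fst (AD m)"
    then have "U i j = inner_vertex (V i (j - 1))"
      by simp
    with * show "U i j \<in> inner_vertex ` fst (AD m)"
      by blast
  qed
  then show ?thesis
    by auto
qed

lemma V_in_inner_AD: "V i j \<in> inner_vertex ` fst (AD m) \<longleftrightarrow> 1 \<le> i \<and> i \<le> Suc m \<and> 1 \<le> j \<and> j \<le> m"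
proof -
  have "V i j \<in> inner_vertex ` fst (AD m) \<longleftrightarrow> 1 \<le> i \<and> U (i - 1) j \<in> fst (AD m)"
  proof
    assume "V i j \<in> inner_vertex ` fst (AD m)"
    then obtain v where "v \<in> fst (AD m)" "V i j = inner_vertex v"
      by blast
    then show "1 \<le> i \<and> U (i - 1) j \<in> fst (AD m)"
      by (cases v) auto
  next
    assume *: "1 \<le> i \<and> U (i - 1) j \<in> fst (AD m)"
    then have "V i j = inner_vertex (U (i - 1) j)"
      by simp
    with * show "V i j \<in> inner_vertex ` fst (AD m)"
      by blast
  qed
  then show ?thesis
    by auto
qed

text \<open>Both endpoints of \<open>eps r s\<close> are inner iff \<open>r div 2\<close> and
  \<open>s div 2\<close> lie between 1 and \<open>m\<close>, that is, \<open>r\<close> and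
  \<open>s\<close> lie between 2 and \<open>2*m + 1\<close>. This is the array of
  \<open>AD m\<close> shifted by one in both directions.\<close>

lemma inner_AD_edges:
  "{e \<in> snd (AD (Suc m)). e \<subseteq> inner_vertex ` fst (AD m)} = (`) inner_vertex ` snd (AD m)"
proof (intro set_eqI iffI)
  fix e assume "e \<in> {e \<in> snd (AD (Suc m)). e \<subseteq> inner_vertex ` fst (AD m)}"
  then obtain r s where rs: "e = eps r s" "eps r s \<subseteq> inner_vertex ` fst (AD m)"
    unfolding snd_AD by blast
  then have "1 \<le> r div 2" "r div 2 \<le> m" "1 \<le> s div 2" "s div 2 \<le> m"
    by (simp_all add: eps_def U_in_inner_AD V_in_inner_AD)
  then have "r - 1 \<in> {1..2*m}" "s - 1 \<in> {1..2*m}" "r - 1 + 1 = r" "s - 1 + 1 = s"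
    unfolding atLeastAtMost_iff by linarith+
  moreover from this have "e = inner_vertex ` eps (r - 1) (s - 1)"
    unfolding inner_vertex_eps rs(1) by simp
  ultimately show "e \<in> (`) inner_vertex ` snd (AD m)"
    using eps_in_AD by blast
next
  fix e assume "e \<in> (`) inner_vertex ` snd (AD m)"
  then obtain e' where e': "e = inner_vertex ` e'" "e' \<in> snd (AD m)"
    by blast
  obtain r s where "e' = eps r s" "r \<in> {1..2*m}" "s \<in> {1..2*m}"
    using e'(2) by (rule edge_of_AD)
  then have "e \<in> snd (AD (Suc m))"
    unfolding e'(1) by (simp only: inner_vertex_eps) (rule eps_in_AD; simp)
  moreover have "e \<subseteq> inner_vertex ` fst (AD m)"
    using e' edge_subset_AD by blast
  ultimately show "e \<in> {e \<in> snd (AD (Suc m)). e \<subseteq> inner_vertex ` fst (AD m)}"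
    by simp
qed

lemma inner_AD_subset: "inner_vertex ` fst (AD m) \<subseteq> fst (AD (Suc m))"
proof
  fix v assume "v \<in> inner_vertex ` fst (AD m)"
  then show "v \<in> fst (AD (Suc m))"
    by (cases v) (simp_all add: U_in_inner_AD V_in_inner_AD)
qed

lemma other_cell:
  assumes "v \<in> inner_vertex ` fst (AD m)" "c \<in> cells_of (Suc m) v"
  shows "other_cell v c \<noteq> c \<and> other_cell v (other_cell v c) = c \<and>
    cells_of (Suc m) v = {c, other_cell v c}"
proof (cases v)
  case (U i j)
  then have ij: "1 \<le> i" "i \<le> m" "1 \<le> j"
    using assms(1) by (simp_all add: U_in_inner_AD)
  then have K: "cells_of (Suc m) v = {(i - 1, j - 1), (i, j - 1)}"
    unfolding U by auto
  have "other_cell v (i - 1, j - 1) = (i, j - 1)" "other_cell v (i, j - 1) = (i - 1, j - 1)"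
    using ij unfolding U by auto
  moreover have "c = (i - 1, j - 1) \<or> c = (i, j - 1)"
    using assms(2) unfolding K by simp
  ultimately show ?thesis
    using ij unfolding K by (elim disjE) (simp_all add: insert_commute)
next
  case (V i j)
  then have ij: "1 \<le> i" "1 \<le> j" "j \<le> m"
    using assms(1) by (simp_all add: V_in_inner_AD)
  then have K: "cells_of (Suc m) v = {(i - 1, j - 1), (i - 1, j)}"
    unfolding V by auto
  have "other_cell v (i - 1, j - 1) = (i - 1, j)" "other_cell v (i - 1, j) = (i - 1, j - 1)"
    using ij unfolding V by auto
  moreover have "c = (i - 1, j - 1) \<or> c = (i - 1, j)"
    using assms(2) unfolding K by simp
  ultimately show ?thesis
    using ij unfolding K by (elim disjE) (simp_all add: insert_commute)
qed

lemma boundary_cell: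
  assumes "v \<in> fst (AD (Suc m)) - inner_vertex ` fst (AD m)"
  shows "cells_of (Suc m) v = {boundary_cell v}"
  using assms by (cases v) (auto simp: U_in_inner_AD V_in_inner_AD)

text \<open>The edge \<open>eps r s\<close> of \<open>AD m\<close> becomes
  \<open>eps (r + 1) (s + 1)\<close> in \<open>AD (Suc m)\<close>, which lies in cell
  \<open>(r div 2, s div 2)\<close>; its new weight is that of the opposite edge divided by the
  weight of this cell.\<close>

theorem matching_sum_AD_reduction:
  fixes w :: "nat \<Rightarrow> nat \<Rightarrow> 'a :: field"
  assumes nz: "\<And>a b. a \<le> m \<Longrightarrow> b \<le> m \<Longrightarrow> cell_weight w a b \<noteq> 0"
  shows "matching_sum (AD (Suc m)) (on_array w) =
    (\<Prod>a\<le>m. \<Prod>b\<le>m. cell_weight w a b) *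
    matching_sum (AD m) (on_array (\<lambda>r s.
      w (cell_opp (r + 1)) (cell_opp (s + 1)) / cell_weight w (r div 2) (s div 2)))"
proof -
  define n where "n = Suc m"
  define E where "E = snd (AD n)"
  define F where "F c = {e \<in> E. cell_of_edge e = c}" for c
  define X where "X = fst (AD n)"
  define X' where "X' = inner_vertex ` fst (AD m)"
  define C where "C = {..<n} \<times> {..<n}"
  define D where "D = (\<lambda>(a, b). cell_weight w a b)"
  define wt where "wt = on_array w"
  \<comment> \<open>The new weights in the coordinates of the larger diamond, before the shift by
    one. Rows and columns count from 1, cells from 0.\<close>
  define wt' where "wt' = on_array (\<lambda>r s.
    w (cell_opp r) (cell_opp s) / cell_weight w ((r - 1) div 2) ((s - 1) div 2))"
  have "X' \<subseteq> X"
    using inner_AD_subset by (simp add: X_def X'_def n_def)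
  have fin: "finite E" "finite X" "finite C"
    using finite_AD by (simp_all add: E_def X_def C_def)
  have cl: "cell_of_edge ` E \<subseteq> C"
  proof (intro image_subsetI)
    fix e assume e: "e \<in> E"
    then have "e \<noteq> {}" "e \<subseteq> X"
      using edge_subset_AD by (auto simp: E_def X_def snd_AD eps_def)
    then obtain v where "v \<in> e" "v \<in> X"
      by blast
    then show "cell_of_edge e \<in> C"
      using cell_of_edge_in_cells_of[of e n v] cells_of_subset[of v n] e
      by (auto simp: C_def E_def X_def)
  qed
  have KC: "cells_of n v \<subseteq> C" if "v \<in> X" for v
    using cells_of_subset that by (simp add: C_def X_def)
  then have K_fin: "finite (cells_of n v)" if "v \<in> X" for v
    using fin that by (meson finite_subset)
  have cell: "induced_sum (F c) ({v \<in> X. c \<in> cells_of n v} - R) wt = D c * induced_sum (F c) R wt'"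
    if "c \<in> C" and R: "R \<subseteq> {v \<in> X. c \<in> cells_of n v}" for c R
  proof -
    obtain a b where c: "c = (a, b)" and ab: "a < n" "b < n"
      using \<open>c \<in> C\<close> by (auto simp: C_def)
    have odd_div: "(2 * k + 2 - 1) div 2 = k" for k :: nat
      by linarith
    have wt': "wt' (eps (2*a + 1) (2*b + 1)) = wt (eps (2*a + 2) (2*b + 2)) / D c"
      "wt' (eps (2*a + 2) (2*b + 2)) = wt (eps (2*a + 1) (2*b + 1)) / D c"
      "wt' (eps (2*a + 1) (2*b + 2)) = wt (eps (2*a + 2) (2*b + 1)) / D c"
      "wt' (eps (2*a + 2) (2*b + 1)) = wt (eps (2*a + 1) (2*b + 2)) / D c"
      unfolding wt_def wt'_def on_array_eps odd_div by (simp_all add: cell_opp_def D_def c)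
    have "D c = wt (eps (2*a + 1) (2*b + 1)) * wt (eps (2*a + 2) (2*b + 2)) +
        wt (eps (2*a + 1) (2*b + 2)) * wt (eps (2*a + 2) (2*b + 1))"
      unfolding wt_def on_array_eps by (simp add: D_def c cell_weight_def)
    moreover have "D c \<noteq> 0"
      using nz ab by (simp add: D_def c n_def)
    ultimately show ?thesis
      using R wt' unfolding c F_def E_def X_def edges_of_cell[OF ab] vertices_of_cell[OF ab] eps_cell
      by (intro induced_sum_four_cycle_complement) simp_all
  qed
  have "matching_sum (AD n) wt = induced_sum E X wt"
    unfolding induced_sum_def E_def X_def using edge_subset_AD[of _ n]
    by (metis (no_types, lifting) Collect_cong Collect_mem_eq prod.collapse)
  also have "\<dots> = (\<Sum>\<sigma> \<in> PiE X (cells_of n). \<Prod>c\<in>C. induced_sum (F c) {v \<in> X. \<sigma> v = c} wt)"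
    unfolding F_def using fin cl K_fin KC
    by (intro induced_sum_cells) (simp_all add: cell_of_edge_in_cells_of E_def)
  also have "\<dots> = (\<Sum>\<sigma> \<in> PiE X' (cells_of n). \<Prod>c\<in>C.
      induced_sum (F c) ({v \<in> X. c \<in> cells_of n v} - {v \<in> X'. \<sigma> v = c}) wt)"
    using \<open>X' \<subseteq> X\<close> other_cell[of _ m] boundary_cell[of _ m] unfolding n_def X_def X'_def
    by (intro sum_PiE_complement)
  also have "\<dots> = (\<Sum>\<sigma> \<in> PiE X' (cells_of n). \<Prod>c\<in>C. D c * induced_sum (F c) {v \<in> X'. \<sigma> v = c} wt')"
  proof (intro sum.cong prod.cong refl cell)
    fix \<sigma> c assume "\<sigma> \<in> PiE X' (cells_of n)"
    then show "{v \<in> X'. \<sigma> v = c} \<subseteq> {v \<in> X. c \<in> cells_of n v}"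
      using PiE_mem[of \<sigma> X' "cells_of n"] \<open>X' \<subseteq> X\<close> by auto
  qed
  also have "\<dots> = (\<Prod>c\<in>C. D c) *
      (\<Sum>\<sigma> \<in> PiE X' (cells_of n). \<Prod>c\<in>C. induced_sum (F c) {v \<in> X'. \<sigma> v = c} wt')"
    by (simp add: prod.distrib sum_distrib_left)
  \<comment> \<open>The cell decomposition read backwards, now on the inner vertices; edges meeting
    the boundary drop out because the sums are induced on subsets of \<open>X'\<close>.\<close>
  also have "(\<Sum>\<sigma> \<in> PiE X' (cells_of n). \<Prod>c\<in>C. induced_sum (F c) {v \<in> X'. \<sigma> v = c} wt') =
      induced_sum E X' wt'"
    unfolding F_def using fin cl K_fin KC finite_subset[OF \<open>X' \<subseteq> X\<close>] subsetD[OF \<open>X' \<subseteq> X\<close>]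
    by (intro induced_sum_cells[symmetric]) (simp_all add: cell_of_edge_in_cells_of E_def)
  also have "\<dots> = matching_sum (inner_vertex ` fst (AD m), (`) inner_vertex ` snd (AD m)) wt'"
    by (simp add: induced_sum_def E_def X'_def n_def inner_AD_edges)
  also have "\<dots> = matching_sum (AD m) (\<lambda>e. wt' (inner_vertex ` e))"
    by (simp add: matching_sum_image inj_inner_vertex)
  also have "\<dots> = matching_sum (AD m) (on_array (\<lambda>r s.
      w (cell_opp (r + 1)) (cell_opp (s + 1)) / cell_weight w (r div 2) (s div 2)))"
    by (rule matching_sum_cong) (auto simp: snd_AD inner_vertex_eps wt'_def)
  also have "(\<Prod>c\<in>C. D c) = (\<Prod>a\<le>m. \<Prod>b\<le>m. cell_weight w a b)"
    by (simp add: C_def D_def prod.cartesian_product n_def lessThan_Suc_atMost)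
  finally show ?thesis
    by (simp add: wt_def n_def)
qed

section \<open>The two-column weights\<close>

definition is_monomial :: "ratfun \<Rightarrow> bool" where
  "is_monomial f \<longleftrightarrow> (\<exists>p. f = Fract (Poly_Mapping.single p 1) 1)"

lemma is_monomial_indet: "is_monomial (indet k)"
  by (auto simp: is_monomial_def indet_def)

lemma is_monomial_mult: "is_monomial f \<Longrightarrow> is_monomial g \<Longrightarrow> is_monomial (f * g)"
  by (auto simp: is_monomial_def mult_single)

text \<open>The coefficient at \<open>p\<close> is 1 or, if the monomials coincide, 2, which is
  nonzero in the rationals.\<close>

lemma is_monomial_sum_nonzero:
  assumes "is_monomial f" "is_monomial g"
  shows "f + g \<noteq> 0"
proof -
  obtain p q where fg: "f = Fract (Poly_Mapping.single p 1) 1" "g = Fract (Poly_Mapping.single q 1) 1"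
    using assms by (auto simp: is_monomial_def)
  have "Poly_Mapping.lookup (Poly_Mapping.single p 1 + Poly_Mapping.single q (1::rat)) p \<noteq> 0"
    by (auto simp: lookup_add lookup_single when_def)
  then have "Poly_Mapping.single p 1 + Poly_Mapping.single q (1::rat) \<noteq> 0"
    by auto
  then show ?thesis
    by (simp add: fg Zero_fract_def eq_fract)
qed

lemma is_monomial_nonzero:
  assumes "is_monomial f"
  shows "f \<noteq> 0"
  using is_monomial_sum_nonzero[OF assms assms] by auto

text \<open>For the product of the cell weights along a row of cells, which alternate between
  \<open>d\<close> and \<open>d / t\<^sup>2\<close>; among \<open>n\<close> cells the second kind
  occurs \<open>n div 2\<close> times.\<close>

lemma prod_cell_weights:
  fixes d t :: "'a :: field"
  shows "(\<Prod>b<n. if even b then d else d / t\<^sup>2) = d ^ n / t ^ (2 * (n div 2))"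
proof (induction n)
  case (Suc n)
  have "t ^ (2 * (Suc n div 2)) = t ^ (2 * (n div 2)) * (if even n then 1 else t\<^sup>2)"
    by (simp add: power_add flip: power_add)
  with Suc show ?case
    by (simp add: mult.commute)
qed simp

text \<open>For each \<open>i\<close> there are \<open>m\<close> vertices
  \<open>U i j\<close>.\<close>

lemma prod_U_AD:
  fixes f :: "nat \<Rightarrow> 'a :: comm_semiring_1"
  shows "(\<Prod>v\<in>fst (AD m). case v of U i j \<Rightarrow> f i | V i j \<Rightarrow> 1) = (\<Prod>i\<le>m. f i ^ m)"
proof -
  let ?h = "\<lambda>v. case v of U i j \<Rightarrow> f i | V i j \<Rightarrow> 1"
  have "(\<Prod>v\<in>fst (AD m). ?h v) = (\<Prod>v\<in>(\<lambda>(i, j). U i j) ` ({..m} \<times> {1..m}). ?h v) *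
      (\<Prod>v\<in>(\<lambda>(i, j). V i j) ` ({1..m} \<times> {..m}). ?h v)"
    unfolding fst_AD_eq by (rule prod.union_disjoint) auto
  also have "(\<Prod>v\<in>(\<lambda>(i, j). V i j) ` ({1..m} \<times> {..m}). ?h v) = 1"
    by (rule prod.neutral) auto
  also have "(\<Prod>v\<in>(\<lambda>(i, j). U i j) ` ({..m} \<times> {1..m}). ?h v) = (\<Prod>(i, j)\<in>{..m} \<times> {1..m}. f i)"
    by (subst prod.reindex) (auto simp: inj_on_def intro: prod.cong)
  also have "\<dots> = (\<Prod>i\<le>m. f i ^ m)"
    by (simp flip: prod.cartesian_product)
  finally show ?thesis
    by simp
qed

text \<open>Both parities in one formula: row \<open>r\<close> of \<open>AD m\<close> is row
  \<open>r + 1\<close> of \<open>AD (Suc m)\<close>, and \<open>cell_opp (r + 1)\<close> is the row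
  of the opposite edges.\<close>

lemma r_op_row:
  assumes "1 \<le> r"
  shows "r_op S T r = (fst (T (cell_opp (r + 1))) / S (r div 2 + 1),
    S (r div 2 + 1) / snd (T (cell_opp (r + 1))))"
proof (cases "odd r")
  case True
  then obtain k where "r = 2 * k + 1"
    by (rule oddE)
  then show ?thesis
    by (simp add: r_op_def cell_opp_def)
next
  case False
  then obtain k where "r = 2 * k"
    by (auto elim: evenE)
  then show ?thesis
    by (simp add: r_op_def cell_opp_def)
qed

text \<open>The result over any field, with \<open>S\<close> any choice of square roots. Here
  \<open>m\<close> is one less than the order, so odd \<open>m\<close> is the case of even
  order.\<close>

theorem matching_sum_y_weight:
  fixes x y S \<Delta> :: "nat \<Rightarrow> 'a :: field" and T :: "'a rows"
  assumes nz: "\<And>i. x i \<noteq> 0" "\<And>i. y i \<noteq> 0" "\<And>i. \<Delta> i \<noteq> 0"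
    and T: "\<And>i. T i = (x i, y i)"
    and \<Delta>: "\<And>i. \<Delta> i = x (2*i - 1) * y (2*i) + x (2*i) * y (2*i - 1)"
    and S: "\<And>i. (S i)\<^sup>2 = x (2*i - 1) * y (2*i - 1) * x (2*i) * y (2*i)"
  shows "matching_sum (AD (Suc m)) (y_weight T) =
    matching_sum (AD m) (y_weight (r_op S T)) *
    (\<Prod>i = 1..Suc m. if odd m then \<Delta> i / S i else \<Delta> i)"
proof -
  have S_nz: "S i \<noteq> 0" for i
    using S[of i] nz by auto
  define w where "w = (\<lambda>r s :: nat.
    if s mod 4 = 1 then x r else if s mod 4 = 2 then y r
    else if s mod 4 = 3 then 1 / x r else 1 / y r)"
  have w_0: "w r (4 * q) = 1 / y r" and w_1: "w r (4 * q + 1) = x r"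
    and w_2: "w r (4 * q + 2) = y r" and w_3: "w r (4 * q + 3) = 1 / x r" for r q :: nat
  proof -
    have "(4 * q) mod 4 = 0" "(4 * q + 1) mod 4 = 1" "(4 * q + 2) mod 4 = 2" "(4 * q + 3) mod 4 = 3"
      by presburger+
    then show "w r (4 * q) = 1 / y r" "w r (4 * q + 1) = x r"
      "w r (4 * q + 2) = y r" "w r (4 * q + 3) = 1 / x r"
      unfolding w_def by (simp_all del: One_nat_def add_2_eq_Suc')
  qed
  \<comment> \<open>For even \<open>b\<close> the columns are 1 and 2 modulo 4; for odd
    \<open>b\<close> they are 3 and 0, where all four weights are inverted, which divides the sum by
    the product of the four entries.\<close>
  have D: "cell_weight w a b = (if even b then \<Delta> (a + 1) else \<Delta> (a + 1) / (S (a + 1))\<^sup>2)" for a b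
  proof (cases "even b")
    case True
    then obtain q where "2 * b = 4 * q"
      by (auto elim!: evenE)
    with True show ?thesis
      by (simp add: cell_weight_def w_1[of _ q, simplified] w_2[of _ q, simplified] \<Delta>)
  next
    case False
    then obtain q where q: "2 * b + 1 = 4 * q + 3" "2 * b + 2 = 4 * (q + 1)"
      by (auto elim!: oddE)
    have "cell_weight w a b = 1 / x (2*a + 1) * (1 / y (2*a + 2)) + 1 / y (2*a + 1) * (1 / x (2*a + 2))"
      unfolding cell_weight_def q w_0 w_3 by simp
    also have "\<dots> = \<Delta> (a + 1) / (S (a + 1))\<^sup>2"
      using nz(1,2) by (simp add: \<Delta> S divide_simps)
    finally show ?thesis
      using False by simp
  qed
  \<comment> \<open>Up to the factor \<open>S i / \<Delta> i\<close>, which does not depend on the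
    column, the reduced weights are those of \<open>r_op S T\<close>.\<close>
  have w': "w (cell_opp (r + 1)) (cell_opp (s + 1)) / cell_weight w (r div 2) (s div 2) =
      S (r div 2 + 1) / \<Delta> (r div 2 + 1) * y_weight (r_op S T) (eps r s)" if "1 \<le> r" for r s
  proof -
    define \<rho> i where "\<rho> = cell_opp (r + 1)" and "i = r div 2 + 1"
    have R: "fst (r_op S T r) = x \<rho> / S i" "snd (r_op S T r) = S i / y \<rho>"
      by (simp_all add: r_op_row[OF that] T \<rho>_def i_def)
    define q where "q = s div 4"
    consider "s = 4 * q" | "s = 4 * q + 1" | "s = 4 * q + 2" | "s = 4 * q + 3"
      unfolding q_def by linarith
    then have "w \<rho> (cell_opp (s + 1)) / cell_weight w (r div 2) (s div 2) =
      S i / \<Delta> i * y_weight (r_op S T) (eps r s)"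
    proof cases
      case 1
      then have "cell_opp (s + 1) = 4 * q + 2" "s div 2 = 2 * q" "s mod 4 = 0"
        by (simp_all add: cell_opp_def)
      then show ?thesis
        using nz S_nz by (simp add: D w_2[simplified] y_weight_eps R i_def)
    next
      case 2
      then have "cell_opp (s + 1) = 4 * q + 1" "s div 2 = 2 * q" "s mod 4 = 1"
        by (simp_all add: cell_opp_def)
      then show ?thesis
        using nz S_nz by (simp add: D w_1[simplified] y_weight_eps R i_def)
    next
      case 3
      then have "cell_opp (s + 1) = 4 * (q + 1)"
        by (simp add: cell_opp_def)
      moreover have "s div 2 = 2 * q + 1" "s mod 4 = 2"
        using 3 by presburger+
      ultimately show ?thesis
        using nz S_nz by (simp add: D w_0 y_weight_eps R i_def power2_eq_square del: mult_Suc_right)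
    next
      case 4
      then have "cell_opp (s + 1) = 4 * q + 3"
        by (simp add: cell_opp_def)
      moreover have "s div 2 = 2 * q + 1" "s mod 4 = 3"
        using 4 by presburger+
      ultimately show ?thesis
        using nz S_nz by (simp add: D w_3[simplified] y_weight_eps R i_def power2_eq_square)
    qed
    then show ?thesis
      by (simp add: \<rho>_def i_def)
  qed
  \<comment> \<open>The factor depends only on \<open>r div 2\<close>, the first index of the
    \<open>U\<close> endpoint of \<open>eps r s\<close>, so the gauge can be put on the
    \<open>U\<close> vertices alone.\<close>
  define h where "h v = (case v of U i j \<Rightarrow> S (i + 1) / \<Delta> (i + 1) | V i j \<Rightarrow> 1)" for v
  have "matching_sum (AD m) (on_array (\<lambda>r s.
      w (cell_opp (r + 1)) (cell_opp (s + 1)) / cell_weight w (r div 2) (s div 2))) =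
    matching_sum (AD m) (\<lambda>e. (\<Prod>v\<in>e. h v) * y_weight (r_op S T) e)"
  proof (rule matching_sum_cong)
    fix e assume "e \<in> snd (AD m)"
    then obtain r s where rs: "e = eps r s" "r \<in> {1..2*m}" "s \<in> {1..2*m}"
      by (rule edge_of_AD)
    have "(\<Prod>v\<in>eps r s. h v) = S (r div 2 + 1) / \<Delta> (r div 2 + 1)"
      by (simp add: eps_def h_def)
    with w'[of r s] rs show "on_array (\<lambda>r s.
        w (cell_opp (r + 1)) (cell_opp (s + 1)) / cell_weight w (r div 2) (s div 2)) e =
      (\<Prod>v\<in>e. h v) * y_weight (r_op S T) e"
      by simp
  qed
  also have "\<dots> = (\<Prod>v\<in>fst (AD m). h v) * matching_sum (AD m) (y_weight (r_op S T))"
    using matching_sum_gauge[of "fst (AD m)" "snd (AD m)" h "y_weight (r_op S T)"]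
    by (simp add: finite_AD edge_subset_AD)
  also have "(\<Prod>v\<in>fst (AD m). h v) = (\<Prod>a\<le>m. (S (a + 1) / \<Delta> (a + 1)) ^ m)"
    unfolding h_def by (rule prod_U_AD)
  finally have inner: "matching_sum (AD m) (on_array (\<lambda>r s.
      w (cell_opp (r + 1)) (cell_opp (s + 1)) / cell_weight w (r div 2) (s div 2))) =
    (\<Prod>a\<le>m. (S (a + 1) / \<Delta> (a + 1)) ^ m) * matching_sum (AD m) (y_weight (r_op S T))" .
  have outer: "(\<Prod>b\<le>m. cell_weight w a b) = \<Delta> (a + 1) ^ Suc m / S (a + 1) ^ (2 * (Suc m div 2))" for a
    unfolding D lessThan_Suc_atMost[symmetric] by (rule prod_cell_weights)
  \<comment> \<open>The contribution of one row of cells: the product of its cell weights times the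
    gauge factor of \<open>m\<close> vertices. The power of \<open>t\<close> cancels completely
    exactly when the number \<open>Suc m\<close> of cells is odd; otherwise one \<open>t\<close> is
    left in the denominator.\<close>
  have factor: "d ^ Suc m / t ^ (2 * (Suc m div 2)) * (t / d) ^ m = (if odd m then d / t else d)"
    if "d \<noteq> 0" "t \<noteq> 0" for d t :: 'a
  proof (cases "odd m")
    case True
    then have "2 * (Suc m div 2) = Suc m"
      by simp
    with True that show ?thesis
      by (simp add: power_divide)
  next
    case False
    then have "2 * (Suc m div 2) = m"
      by simp
    with False that show ?thesis
      by (simp add: power_divide)
  qed
  have "y_weight T = on_array w"
    unfolding y_weight_on_array w_def T fst_conv snd_conv ..
  moreover have "cell_weight w a b \<noteq> 0" for a b
    using nz S_nz by (simp add: D)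
  ultimately have "matching_sum (AD (Suc m)) (y_weight T) =
    (\<Prod>a\<le>m. \<Delta> (a + 1) ^ Suc m / S (a + 1) ^ (2 * (Suc m div 2))) *
    ((\<Prod>a\<le>m. (S (a + 1) / \<Delta> (a + 1)) ^ m) * matching_sum (AD m) (y_weight (r_op S T)))"
    by (simp only: matching_sum_AD_reduction inner outer not_False_eq_True)
  also have "\<dots> = (\<Prod>a\<le>m. if odd m then \<Delta> (a + 1) / S (a + 1) else \<Delta> (a + 1)) *
      matching_sum (AD m) (y_weight (r_op S T))"
    unfolding mult.assoc[symmetric] prod.distrib[symmetric] factor[OF nz(3) S_nz] ..
  also have "(\<Prod>a\<le>m. if odd m then \<Delta> (a + 1) / S (a + 1) else \<Delta> (a + 1)) =
      (\<Prod>i = 1..Suc m. if odd m then \<Delta> i / S i else \<Delta> i)"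
    unfolding One_nat_def prod.atLeast1_atMost_eq lessThan_Suc_atMost add_Suc_right add_0_right ..
  finally show ?thesis
    by (simp only: mult.commute)
qed

theorem theorem4p1:
  fixes n :: nat
    and x y S \<Delta> :: "nat \<Rightarrow> ratfun"
    and T :: "ratfun rows"
  assumes "n \<ge> 1"
    and "\<And>i. x i = (xi i)\<^sup>2"
    and "\<And>i. y i = (eta i)\<^sup>2"
    and "\<And>i. T i = (x i, y i)"
    and "\<And>i. \<Delta> i = x (2*i - 1) * y (2*i) + x (2*i) * y (2*i - 1)"
    and "\<And>i. S i = xi (2*i - 1) * eta (2*i - 1) * xi (2*i) * eta (2*i)"
  shows "(even n \<longrightarrow>
           matching_sum (AD n) (y_weight T) =
             matching_sum (AD (n - 1)) (y_weight (r_op S T)) * (\<Prod>i = 1..n. \<Delta> i / S i)) \<and>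
         (odd n \<longrightarrow>
           matching_sum (AD n) (y_weight T) =
             matching_sum (AD (n - 1)) (y_weight (r_op S T)) * (\<Prod>i = 1..n. \<Delta> i))"
proof -
  obtain m where n: "n = Suc m"
    using \<open>n \<ge> 1\<close> by (cases n) auto
  have mon: "is_monomial (x i)" "is_monomial (y i)" for i
    by (simp_all add: assms(2,3) xi_def eta_def power2_eq_square is_monomial_mult is_monomial_indet)
  \<comment> \<open>This includes \<open>i = 0\<close>, where \<open>2*i - 1\<close> truncates to 0
    and both summands coincide.\<close>
  have "\<Delta> i \<noteq> 0" for i
    unfolding assms(5) by (intro is_monomial_sum_nonzero is_monomial_mult mon)
  moreover have "(S i)\<^sup>2 = x (2*i - 1) * y (2*i - 1) * x (2*i) * y (2*i)" for i
    by (simp only: assms(2,3,6) power_mult_distrib)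
  ultimately have "matching_sum (AD (Suc m)) (y_weight T) =
    matching_sum (AD m) (y_weight (r_op S T)) *
    (\<Prod>i = 1..Suc m. if odd m then \<Delta> i / S i else \<Delta> i)"
    using mon[THEN is_monomial_nonzero] assms(4,5) by (intro matching_sum_y_weight)
  \<comment> \<open>With \<open>n = Suc m\<close>, odd \<open>m\<close> means even
    \<open>n\<close>.\<close>
  then show ?thesis
    by (simp add: n)
qed

end
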